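(* Let $f$ be a function, and let $z_1$ be a termination function such that the generalized integral of $f$ over $[a,\infty)$ exists with respect to $z_1$. Let $z_2$ be an arbitrary termination function, and let $z = z_1 \odot z_2$ be the combined termination function of $z_1$ and $z_2$. Then the generalized integral of $f$ over $[a,\infty)$ with respect to $z$ exists and has the same value as the generalized integral of $f$ over $[a,\infty)$ with respect to $z_1$.
   Context: A termination function is a function $z:\mathbb{R}\to\mathbb{R}$ for which there is a finite constant $c>0$ such that $z(x)=1$ for $x\le 0$, $z(x)=0$ for $x\ge c$, $z'(x)\le 0$, and $\int_{-\infty}^{\infty} z'(x)\,dx=\int_0^c z'(x)\,dx=-1$. So $z$ is nonincreasing from $1$ to $0$. Jumps of $z$ are allowed, with $z'$ understood in the generalized sense (a jump contributes a Dirac delta, and integrals $\int_0^c\cdots z'(x)\,dx$ include point masses at the endpoints). The function $z$ does not depend on the limit variable $b$ below. The generalized integral of $f$ over $[a,\infty)$ with respect to $z$ is $$\lim_{b\to\infty}\left\{\int_a^b f(x)\,dx+\int_b^{b+c} f(x)\,z(x-b)\,dx\right\}.$$ It is said to exist with respect to $z$ when the (conventional, e.g. Riemann) integrals and the limit exist; its value is then the value of the limit. Given termination functions $z_1,z_2$ (with constants $c_1,c_2$), their combined termination function $z=z_1\odot z_2$ is defined by $z'(x)=-\int_{-\infty}^{\infty} z_1'(x-x')\,z_2'(x')\,dx'$ and $z(x)=1+\int_{-\infty}^{x} z'(x')\,dx'$. It is a termination function with constant $c=c_1+c_2$. *)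

theory Defs
  imports "HOL-Probability.Probability"
begin

text \<open>
  The generalized derivative of a nonincreasing \<open>z\<close> is a nonpositive Borel measure \<open>z'(x) dx\<close> in which
  a jump of \<open>z\<close> is a point mass. The nonnegative measure \<open>- z'(x) dx\<close> is the Stieltjes measure with
  distribution function \<open>1 - z(x+)\<close>; the one-sided limit is taken since the value of \<open>z\<close> at a jump
  does not enter \<open>z'\<close>.
\<close>
definition neg_deriv :: "(real \<Rightarrow> real) \<Rightarrow> real measure" where
  "neg_deriv z = interval_measure (\<lambda>x. 1 - Lim (at_right x) z)"

text \<open>
  Here \<open>z' \<le> 0\<close>, in the generalized sense, is monotonicity of \<open>z\<close>. The last two conditions,
  \<open>\<integral> z' = -1\<close> over the line and over \<open>[0, c]\<close> with endpoint masses included, are consequences of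
  the others; see \<open>termination_function_iff\<close> below.
\<close>
definition termination_function :: "real \<Rightarrow> (real \<Rightarrow> real) \<Rightarrow> bool" where
  "termination_function c z \<longleftrightarrow>
     0 < c \<and> (\<forall>x\<le>0. z x = 1) \<and> (\<forall>x\<ge>c. z x = 0) \<and> antimono z \<and>
     emeasure (neg_deriv z) UNIV = 1 \<and> emeasure (neg_deriv z) {0..c} = 1"

lemma antimono_tendsto_at_right:
  fixes z :: "real \<Rightarrow> real"
  assumes "antimono z"
  shows "(z \<longlongrightarrow> Lim (at_right x) z) (at_right x)"
proof -
  have "((\<lambda>y. - z y) \<longlongrightarrow> Inf ((\<lambda>y. - z y) ` ({x<..} \<inter> UNIV))) (at x within ({x<..} \<inter> UNIV))"
    by (rule Lim_right_bound[where K = "- z x"]) (use assms in \<open>auto simp: antimono_def\<close>)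
  then have "(z \<longlongrightarrow> - Inf ((\<lambda>y. - z y) ` {x<..})) (at_right x)"
    using tendsto_minus by fastforce
  then show ?thesis
    by (metis tendsto_Lim trivial_limit_at_right_real)
qed

lemma antimono_right_limit_bounds:
  fixes z :: "real \<Rightarrow> real"
  assumes "antimono z"
  shows "Lim (at_right x) z \<le> z x" and "x < y \<Longrightarrow> z y \<le> Lim (at_right x) z"
proof -
  note lim = antimono_tendsto_at_right[OF assms, of x]
  show "Lim (at_right x) z \<le> z x"
    by (rule tendsto_upperbound[OF lim])
      (use assms in \<open>auto simp: eventually_at_right_less antimono_def eventually_at_filter\<close>)
  show "z y \<le> Lim (at_right x) z" if "x < y"
    by (rule tendsto_lowerbound[OF lim])
      (use assms that in \<open>auto simp: antimono_def eventually_at_right intro!: exI[of _ y]\<close>)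
qed

lemma neg_deriv_props:
  fixes z :: "real \<Rightarrow> real"
  assumes "0 < c" and z0: "\<And>x. x \<le> 0 \<Longrightarrow> z x = 1" and zc: "\<And>x. x \<ge> c \<Longrightarrow> z x = 0"
    and anti: "antimono z"
  shows real_distribution_neg_deriv: "real_distribution (neg_deriv z)"
    and cdf_neg_deriv: "cdf (neg_deriv z) x = 1 - Lim (at_right x) z"
    and emeasure_neg_deriv_Icc: "emeasure (neg_deriv z) {0..c} = 1"
proof -
  define F where "F = (\<lambda>x. 1 - Lim (at_right x) z)"
  note b = antimono_right_limit_bounds[OF anti]
  have F0: "F x = 0" if "x < 0" for x
    using b(1)[of x] b(2)[of x 0] that z0[of x] z0[of 0] by (simp add: F_def)
  have Fc: "F x = 1" if "x \<ge> c" for x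
    using b(1)[of x] b(2)[of x "x + 1"] that zc[of x] zc[of "x + 1"] by (simp add: F_def)
  have mono: "F x \<le> F y" if "x \<le> y" for x y
    using b(1)[of y] b(2)[of x y] that by (cases "x = y") (auto simp: F_def)
  have cont: "continuous (at_right x) F" for x
    unfolding continuous_within
  proof (rule tendsto_sandwich[of "\<lambda>_. F x" F _ "\<lambda>y. 1 - z (2 * y - x)"])
    show "eventually (\<lambda>y. F x \<le> F y) (at_right x)"
      by (rule eventually_mono[OF eventually_at_right_less]) (simp add: mono)
    show "eventually (\<lambda>y. F y \<le> 1 - z (2 * y - x)) (at_right x)"
      by (rule eventually_mono[OF eventually_at_right_less]) (simp add: F_def b(2))
    have "filterlim (\<lambda>y. 2 * y - x) (at_right x) (at_right x)"
      unfolding filterlim_at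
      by (auto simp: eventually_at_filter intro!: tendsto_eq_intros)
    from filterlim_compose[OF antimono_tendsto_at_right[OF anti] this]
    show "((\<lambda>y. 1 - z (2 * y - x)) \<longlongrightarrow> F x) (at_right x)"
      unfolding F_def by (intro tendsto_intros)
  qed simp
  have bot: "(F \<longlongrightarrow> 0) at_bot"
    by (rule tendsto_eventually) (auto simp: eventually_at_bot_dense intro!: exI[of _ 0] F0)
  have top: "(F \<longlongrightarrow> 1) at_top"
    by (rule tendsto_eventually) (auto simp: eventually_at_top_linorder intro!: exI[of _ c] Fc)
  have M: "neg_deriv z = interval_measure F"
    by (simp add: neg_deriv_def F_def)
  show rd: "real_distribution (neg_deriv z)"
    unfolding M by (rule real_distribution_interval_measure) (fact mono cont bot top)+
  have cdf: "cdf (neg_deriv z) = F"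
    unfolding M by (rule cdf_interval_measure) (fact mono cont bot)+
  then show "cdf (neg_deriv z) x = 1 - Lim (at_right x) z"
    by (simp add: F_def)
  interpret real_distribution "neg_deriv z" by (fact rd)
  have "(cdf (neg_deriv z) \<longlongrightarrow> 0) (at_left 0)"
    unfolding cdf
    by (rule tendsto_eventually) (auto simp: eventually_at_filter F0)
  then have "measure (neg_deriv z) {..<0} = 0"
    using cdf_at_left[of 0] tendsto_unique trivial_limit_at_left_real by blast
  moreover have "measure (neg_deriv z) {..c} = 1"
    using Fc[of c] cdf by (simp add: cdf_def fun_eq_iff)
  moreover have "measure (neg_deriv z) {..c} = measure (neg_deriv z) {..<0} + measure (neg_deriv z) {0..c}"
    using \<open>0 < c\<close> by (subst finite_measure_Union[symmetric]) (auto simp: ivl_disj_un)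
  ultimately show "emeasure (neg_deriv z) {0..c} = 1"
    by (simp add: emeasure_eq_measure)
qed

lemma termination_function_iff:
  "termination_function c z \<longleftrightarrow>
     0 < c \<and> (\<forall>x\<le>0. z x = 1) \<and> (\<forall>x\<ge>c. z x = 0) \<and> antimono z"
proof -
  have "emeasure (neg_deriv z) UNIV = 1 \<and> emeasure (neg_deriv z) {0..c} = 1"
    if "0 < c" "\<forall>x\<le>0. z x = 1" "\<forall>x\<ge>c. z x = 0" "antimono z"
  proof -
    interpret real_distribution "neg_deriv z"
      by (rule real_distribution_neg_deriv) (use that in auto)
    show ?thesis
      using emeasure_space_1 emeasure_neg_deriv_Icc[of c z] that by simp
  qed
  then show ?thesis
    unfolding termination_function_def by blast
qed

text \<open>
  The integrals over bounded intervals are gauge integrals, so proper Riemann integrals are covered.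
\<close>
definition generalized_integrable ::
    "(real \<Rightarrow> real) \<Rightarrow> real \<Rightarrow> real \<Rightarrow> (real \<Rightarrow> real) \<Rightarrow> bool" where
  "generalized_integrable f a c z \<longleftrightarrow>
     (\<forall>b\<ge>a. f integrable_on {a..b} \<and> (\<lambda>x. f x * z (x - b)) integrable_on {b..b + c}) \<and>
     (\<exists>L. ((\<lambda>b. integral {a..b} f + integral {b..b + c} (\<lambda>x. f x * z (x - b))) \<longlongrightarrow> L) at_top)"

definition generalized_integral ::
    "(real \<Rightarrow> real) \<Rightarrow> real \<Rightarrow> real \<Rightarrow> (real \<Rightarrow> real) \<Rightarrow> real" where
  "generalized_integral f a c z =
     Lim at_top (\<lambda>b. integral {a..b} f + integral {b..b + c} (\<lambda>x. f x * z (x - b)))"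

text \<open>
  With \<open>- z' = (- z\<^sub>1') * (- z\<^sub>2')\<close> (convolution), \<open>z x = 1 + \<integral> z'\<close> over \<open>{..x}\<close>. The case \<open>x \<le> 0\<close>
  matters only at \<open>x = 0\<close>, and only if \<open>z\<^sub>1\<close> and \<open>z\<^sub>2\<close> both jump at \<open>0\<close>: then \<open>z\<close> jumps there as well,
  and a termination function has the value \<open>1\<close> at \<open>0\<close>.
\<close>
definition combined :: "(real \<Rightarrow> real) \<Rightarrow> (real \<Rightarrow> real) \<Rightarrow> real \<Rightarrow> real" (infixl \<open>\<odot>\<close> 70) where
  "(z\<^sub>1 \<odot> z\<^sub>2) x =
     (if x \<le> 0 then 1 else 1 - measure (neg_deriv z\<^sub>1 \<star> neg_deriv z\<^sub>2) {..x})"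

lemma convolution_props:
  assumes "termination_function c\<^sub>1 z\<^sub>1" and "termination_function c\<^sub>2 z\<^sub>2"
  shows real_distribution_convolution_neg_deriv:
      "real_distribution (neg_deriv z\<^sub>1 \<star> neg_deriv z\<^sub>2)"
    and AE_convolution_neg_deriv:
      "AE x in (neg_deriv z\<^sub>1 \<star> neg_deriv z\<^sub>2). 0 \<le> x \<and> x \<le> c\<^sub>1 + c\<^sub>2"
proof -
  let ?M = "neg_deriv z\<^sub>1" and ?N = "neg_deriv z\<^sub>2"
  have rd: "real_distribution ?M" "real_distribution ?N"
    using assms unfolding termination_function_iff by (auto intro: real_distribution_neg_deriv)
  interpret M: real_distribution ?M by (fact rd)
  interpret N: real_distribution ?N by (fact rd)
  interpret MN: pair_prob_space ?M ?N ..
  show "real_distribution (?M \<star> ?N)"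
    unfolding convolution_def by (intro MN.real_distribution_distr) measurable
  have M: "AE x in ?M. x \<in> {0..c\<^sub>1}" and N: "AE x in ?N. x \<in> {0..c\<^sub>2}"
    using assms unfolding termination_function_def
    by (subst M.AE_in_set_eq_1 N.AE_in_set_eq_1;
        simp add: M.emeasure_eq_measure N.emeasure_eq_measure)+
  have "AE x in ?M. AE y in ?N. 0 \<le> x + y \<and> x + y \<le> c\<^sub>1 + c\<^sub>2"
    using M
  proof eventually_elim
    case (elim x)
    show ?case using N by eventually_elim (use elim in auto)
  qed
  moreover have "{p \<in> space (?M \<Otimes>\<^sub>M ?N). 0 \<le> fst p + snd p \<and> fst p + snd p \<le> c\<^sub>1 + c\<^sub>2}
      \<in> sets (?M \<Otimes>\<^sub>M ?N)"
    by measurable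
  ultimately have "AE p in ?M \<Otimes>\<^sub>M ?N. 0 \<le> fst p + snd p \<and> fst p + snd p \<le> c\<^sub>1 + c\<^sub>2"
    by (intro MN.AE_pair_measure) (simp_all only: fst_conv snd_conv)
  then show "AE x in (?M \<star> ?N). 0 \<le> x \<and> x \<le> c\<^sub>1 + c\<^sub>2"
    unfolding convolution_def by (subst AE_distr_iff) (simp_all add: case_prod_beta)
qed

lemma termination_function_combined:
  assumes "termination_function c\<^sub>1 z\<^sub>1" and "termination_function c\<^sub>2 z\<^sub>2"
  shows "termination_function (c\<^sub>1 + c\<^sub>2) (z\<^sub>1 \<odot> z\<^sub>2)"
proof -
  interpret P: real_distribution "neg_deriv z\<^sub>1 \<star> neg_deriv z\<^sub>2"
    by (rule real_distribution_convolution_neg_deriv[OF assms])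
  have "measure (neg_deriv z\<^sub>1 \<star> neg_deriv z\<^sub>2) {..x} = 1" if "c\<^sub>1 + c\<^sub>2 \<le> x" for x
    using AE_convolution_neg_deriv[OF assms]
    by (subst P.prob_eq_1) (use that in \<open>simp, elim eventually_mono, simp\<close>)
  moreover have "0 < c\<^sub>1" "0 < c\<^sub>2"
    using assms by (auto simp: termination_function_def)
  ultimately show ?thesis
    unfolding termination_function_iff
    by (auto simp: combined_def antimono_def intro!: P.finite_measure_mono)
qed

text \<open>The generalized derivative of \<open>z\<^sub>1 \<odot> z\<^sub>2\<close> is the convolution it is defined from.\<close>
lemma neg_deriv_combined:
  assumes "termination_function c\<^sub>1 z\<^sub>1" and "termination_function c\<^sub>2 z\<^sub>2"
  shows "neg_deriv (z\<^sub>1 \<odot> z\<^sub>2) = (neg_deriv z\<^sub>1 \<star> neg_deriv z\<^sub>2)"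
proof -
  let ?P = "neg_deriv z\<^sub>1 \<star> neg_deriv z\<^sub>2"
  have rd: "real_distribution ?P"
    by (rule real_distribution_convolution_neg_deriv[OF assms])
  interpret P: real_distribution ?P by (fact rd)
  note t = termination_function_combined[OF assms, unfolded termination_function_iff]
  have eq: "(z\<^sub>1 \<odot> z\<^sub>2) y = 1 - cdf ?P y" if "y \<noteq> 0" for y
  proof (cases "y < 0")
    case True
    then have "measure ?P {..y} = 0"
      using AE_convolution_neg_deriv[OF assms]
      by (subst P.prob_eq_0) (auto elim!: eventually_mono)
    with True show ?thesis by (simp add: combined_def cdf_def)
  qed (use that in \<open>auto simp: combined_def cdf_def\<close>)
  have "Lim (at_right x) (z\<^sub>1 \<odot> z\<^sub>2) = 1 - cdf ?P x" for x
  proof (rule tendsto_Lim)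
    have "((\<lambda>y. 1 - cdf ?P y) \<longlongrightarrow> 1 - cdf ?P x) (at_right x)"
      using P.cdf_is_right_cont[of x] by (intro tendsto_intros) (simp add: continuous_within)
    moreover have "eventually (\<lambda>y. y \<noteq> 0) (at_right x)"
      by (intro eventually_neq_at_within)
    ultimately show "((z\<^sub>1 \<odot> z\<^sub>2) \<longlongrightarrow> 1 - cdf ?P x) (at_right x)"
      by (subst tendsto_cong[where g = "\<lambda>y. 1 - cdf ?P y"]) (auto elim!: eventually_mono simp: eq)
  qed simp
  moreover have "cdf (neg_deriv (z\<^sub>1 \<odot> z\<^sub>2)) x = 1 - Lim (at_right x) (z\<^sub>1 \<odot> z\<^sub>2)" for x
    using t by (intro cdf_neg_deriv[of "c\<^sub>1 + c\<^sub>2"]) auto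
  ultimately have "cdf (neg_deriv (z\<^sub>1 \<odot> z\<^sub>2)) = cdf ?P"
    by (simp add: fun_eq_iff)
  moreover have "real_distribution (neg_deriv (z\<^sub>1 \<odot> z\<^sub>2))"
    using t by (intro real_distribution_neg_deriv[of "c\<^sub>1 + c\<^sub>2"]) auto
  ultimately show ?thesis
    using rd by (intro cdf_unique)
qed

end

theory Submission
  imports Defs
begin

text \<open>
  Write \<open>F t = integral {a..t} f\<close>, and for a termination function \<open>z\<close> with constant \<open>c\<close> let
  \<open>G b = F b + integral {b..b + c} (\<lambda>x. f x * z (x - b))\<close> be the terminated integral, whose limit is the
  generalized integral. Terminating amounts to averaging \<open>F\<close> over a window of fixed length:
  if \<open>\<mu>\<close> denotes the probability measure \<open>- z'(t) dt\<close> on \<open>{0..c}\<close>, then \<open>G b = (LINT t|\<mu>. F (b + t))\<close>.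
  Indeed \<open>z (x - b)\<close> is the \<open>\<mu>\<close>-measure of \<open>{x - b<..}\<close> for almost all \<open>x\<close>, and the integrals over \<open>x\<close>
  and \<open>t\<close> can be exchanged. As \<open>f\<close> need not be absolutely integrable, this exchange
  (lemma \<open>has_integral_mult_measure_greaterThan\<close>) does not come from Fubini's theorem but from the second
  mean value theorem, which also yields that \<open>f x * z (x - b)\<close> is integrable for every termination
  function \<open>z\<close>.

  For \<open>z = z\<^sub>1 \<odot> z\<^sub>2\<close> the measure \<open>\<mu>\<close> is the convolution of \<open>\<mu>\<^sub>1\<close> and \<open>\<mu>\<^sub>2\<close>. Since \<open>F\<close> is continuous and the
  measures are carried by bounded intervals, Fubini's theorem applies to \<open>F\<close> and gives
  \<open>G b = (LINT s|\<mu>\<^sub>2. LINT t|\<mu>\<^sub>1. F (b + s + t)) = (LINT s|\<mu>\<^sub>2. G\<^sub>1 (b + s))\<close>, where \<open>G\<^sub>1\<close> is the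
  terminated integral for \<open>z\<^sub>1\<close>. So \<open>G b\<close> is an average of values of \<open>G\<^sub>1\<close> at points \<open>\<ge> b\<close>, and it has the same
  limit as \<open>G\<^sub>1\<close> (lemma \<open>tendsto_integral_shift\<close>).
\<close>

section \<open>Exchanging a gauge integral with a finite measure\<close>

lemma (in finite_borel_measure) set_integrable_continuous_Icc:
  fixes g :: "real \<Rightarrow> real"
  assumes "continuous_on {a..b} g"
  shows "set_integrable M {a..b} g"
proof -
  have "bounded (g ` {a..b})"
    using assms by (intro compact_imp_bounded compact_continuous_image) auto
  then obtain B where B: "\<And>x. x \<in> {a..b} \<Longrightarrow> \<bar>g x\<bar> \<le> B"
    unfolding bounded_iff by (metis imageI real_norm_def)
  have "(\<lambda>x. indicator {a..b} x *\<^sub>R g x) \<in> borel_measurable M"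
    using borel_measurable_continuous_on_indicator[OF _ assms] by (simp add: M_is_borel cong: measurable_cong_sets)
  then show ?thesis
    unfolding set_integrable_def
    by (intro integrable_const_bound[of _ "\<bar>B\<bar>"] AE_I2)
      (auto simp: indicator_def intro: order_trans[OF B abs_ge_self])
qed

text \<open>
  Both sides integrate \<open>f x\<close> over \<open>a \<le> x < t \<le> b\<close> with respect to \<open>dx\<close> and \<open>M(dt)\<close>, in either order, for a
  gauge integrable \<open>f\<close>. In the proof, \<open>H t\<close> is the difference of the two sides for the upper
  limit \<open>t\<close> in place of \<open>b\<close>: the term \<open>k t * F t\<close> corrects \<open>k x = measure M {x<..b}\<close> to \<open>measure M {x<..t}\<close>. On short
  intervals, the increments of \<open>H\<close> are bounded by \<open>e\<close> times the measure of the interval, hence \<open>H b = H a = 0\<close>.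
\<close>
lemma (in finite_borel_measure) has_integral_mult_measure_greaterThan:
  fixes f :: "real \<Rightarrow> real"
  assumes "a \<le> b" and f: "f integrable_on {a..b}"
  shows "((\<lambda>x. f x * measure M {x<..b}) has_integral
           (LINT t:{a<..b}|M. integral {a..t} f)) {a..b}"
proof -
  define F where "F t = integral {a..t} f" for t
  define k where "k x = measure M {x<..b}" for x
  define J where "J s t = (LINT u:{s<..t}|M. F u)" for s t
  define H where "H t = integral {a..t} (\<lambda>x. f x * k x) - k t * F t - J a t" for t
  have k_mono: "- k x \<le> - k y" if "x \<le> y" for x y
    unfolding k_def using that by (auto intro!: finite_measure_mono)
  have k_diff: "k s - k t = measure M {s<..t}" if "s \<le> t" "t \<le> b" for s t
  proof -
    have *: "{s<..b} = {s<..t} \<union> {t<..b}" using that by auto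
    have "k s = measure M {s<..t} + measure M {t<..b}"
      unfolding k_def * by (rule finite_measure_Union) auto
    then show ?thesis by (simp add: k_def)
  qed
  have fk: "(\<lambda>x. f x * k x) integrable_on {a..b}"
  proof -
    obtain y where "((\<lambda>x. - k x * f x) has_integral y) {a..b}"
      using second_mean_value_theorem_full[OF f \<open>a \<le> b\<close>, of "\<lambda>x. - k x"] k_mono by blast
    from has_integral_neg[OF this] show ?thesis
      by (auto simp: mult.commute)
  qed
  have cont: "continuous_on {a..b} F"
    unfolding F_def by (rule indefinite_integral_continuous_1[OF f])
  have F_int: "set_integrable M {s<..t} F" if "a \<le> s" "t \<le> b" for s t
    by (rule set_integrable_subset[OF set_integrable_continuous_Icc[OF cont]]) (use that in auto)
  have const_int: "set_integrable M {s<..t} (\<lambda>_. q)" for s t q :: real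
    by (rule set_integrable_subset[OF set_integrable_continuous_Icc[of s t "\<lambda>_. q"]]) auto
  have sub: "integral {a..t} g - integral {a..s} g = integral {s..t} g"
    if "g integrable_on {a..b}" "a \<le> s" "s \<le> t" "t \<le> b" for g :: "real \<Rightarrow> real" and s t
    using Henstock_Kurzweil_Integration.integral_combine[of a s t g] that
    by (simp add: integrable_on_subinterval)
  \<comment> \<open>The second mean value theorem reduces an increment of \<open>H\<close> to the deviation of \<open>F\<close> from one of
    its values.\<close>
  have incr: "\<exists>\<xi>\<in>{s..t}. H t - H s = (LINT u:{s<..t}|M. F \<xi> - F u)"
    if st: "a \<le> s" "s \<le> t" "t \<le> b" for s t
  proof -
    have "f integrable_on {s..t}"
      using f st by (auto intro: integrable_on_subinterval)
    then obtain \<xi> where \<xi>: "\<xi> \<in> {s..t}" and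
      "((\<lambda>x. - k x * f x) has_integral (- k s * integral {s..\<xi>} f + - k t * integral {\<xi>..t} f)) {s..t}"
      using second_mean_value_theorem_full[of f s t "\<lambda>x. - k x"] k_mono st by blast
    then have "((\<lambda>x. f x * k x) has_integral (k s * integral {s..\<xi>} f + k t * integral {\<xi>..t} f)) {s..t}"
      by (drule_tac has_integral_neg) (simp add: mult.commute add.commute)
    then have "integral {s..t} (\<lambda>x. f x * k x) = k s * (F \<xi> - F s) + k t * (F t - F \<xi>)"
      unfolding F_def using sub[OF f, of s \<xi>] sub[OF f, of \<xi> t] \<xi> st by (auto dest: integral_unique)
    moreover have "J a t = J a s + J s t"
    proof -
      have "{a<..t} = {a<..s} \<union> {s<..t}" using st by auto
      then show ?thesis
        unfolding J_def using st by (simp, intro set_integral_Un F_int) auto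
    qed
    ultimately have "H t - H s = (k s - k t) * F \<xi> - J s t"
      using sub[OF fk st] unfolding H_def by (simp add: algebra_simps)
    also have "\<dots> = (LINT u:{s<..t}|M. F \<xi> - F u)"
      unfolding J_def k_diff[OF st(2,3)]
      using set_integral_diff(2)[OF const_int F_int[OF st(1,3)], of "F \<xi>"]
      by (simp add: set_lebesgue_integral_def borel_UNIV)
    finally show ?thesis using \<xi> by blast
  qed
  have small: "\<bar>H b - H a\<bar> \<le> e * measure M {a<..b}" if "e > 0" for e
  proof -
    \<comment> \<open>Both sides of the estimate add up over adjacent intervals, so it suffices to prove it for
      short intervals around each point.\<close>
    define P where "P s t \<longleftrightarrow> (a \<le> s \<longrightarrow> t \<le> b \<longrightarrow> \<bar>H t - H s\<bar> \<le> e * measure M {s<..t})" for s t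
    have "P a b"
    proof (rule Bolzano[OF \<open>a \<le> b\<close>])
      fix s t u
      assume *: "P s t" "P t u" "s \<le> t" "t \<le> u"
      have "e * measure M {s<..u} = e * measure M {s<..t} + e * measure M {t<..u}"
        using *(3,4) by (subst finite_measure_Union[symmetric] distrib_left[symmetric])+
          (auto simp: ivl_disj_un)
      with * show "P s u" unfolding P_def by linarith
    next
      fix x assume x: "a \<le> x" "x \<le> b"
      then obtain d where "d > 0" and d: "\<And>u. u \<in> {a..b} \<Longrightarrow> \<bar>u - x\<bar> < d \<Longrightarrow> \<bar>F u - F x\<bar> < e / 2"
        using cont[unfolded continuous_on_iff, rule_format, of x "e / 2"] \<open>e > 0\<close>
        by (auto simp: dist_real_def)
      have "P s t" if sxt: "s \<le> x" "x \<le> t" "t - s < d" for s t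
        unfolding P_def
      proof (intro impI)
        assume st: "a \<le> s" "t \<le> b"
        obtain \<xi> where \<xi>: "\<xi> \<in> {s..t}" "H t - H s = (LINT u:{s<..t}|M. F \<xi> - F u)"
          using incr[of s t] st sxt by auto
        have osc: "\<bar>F \<xi> - F u\<bar> \<le> e" if "u \<in> {s<..t}" for u
        proof -
          have "\<bar>F u - F x\<bar> < e / 2" "\<bar>F \<xi> - F x\<bar> < e / 2"
            by (rule d; use that \<xi>(1) st sxt in force)+
          then show ?thesis by linarith
        qed
        have "set_integrable M {s<..t} (\<lambda>u. F \<xi> - F u)"
          by (intro set_integral_diff const_int F_int st)
        then have "\<bar>LINT u:{s<..t}|M. F \<xi> - F u\<bar> \<le> (LINT u:{s<..t}|M. e)"
          using const_int[of s t e] unfolding set_integrable_def set_lebesgue_integral_def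
          by (rule integral_abs_bound_integral) (auto simp: indicator_def osc)
        then show "\<bar>H t - H s\<bar> \<le> e * measure M {s<..t}"
          using \<xi> by (simp add: set_lebesgue_integral_def borel_UNIV mult.commute)
      qed
      with \<open>d > 0\<close> show "\<exists>d>0. \<forall>s t. s \<le> x \<and> x \<le> t \<and> t - s < d \<longrightarrow> P s t" by blast
    qed
    then show ?thesis by (simp add: P_def)
  qed
  have "\<bar>H b - H a\<bar> \<le> 0"
  proof (rule field_le_epsilon)
    fix e :: real assume "e > 0"
    let ?m = "measure M {a<..b}"
    have "\<bar>H b - H a\<bar> \<le> e / (1 + ?m) * ?m"
      by (rule small) (use \<open>e > 0\<close> in \<open>simp add: add_pos_nonneg\<close>)
    also have "\<dots> \<le> e"
      using \<open>e > 0\<close> by (simp add: field_simps add_pos_nonneg)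
    finally show "\<bar>H b - H a\<bar> \<le> 0 + e" by simp
  qed
  moreover have "J a a = 0"
    by (simp add: J_def set_lebesgue_integral_def)
  ultimately have "H b = 0"
    by (simp add: H_def F_def)
  then have "integral {a..b} (\<lambda>x. f x * k x) = J a b"
    by (simp add: H_def k_def)
  with fk show ?thesis
    unfolding J_def F_def k_def by (metis integrable_integral)
qed


section \<open>Termination as averaging of the indefinite integral\<close>

lemma AE_neg_deriv:
  assumes "termination_function c z"
  shows "AE t in neg_deriv z. 0 \<le> t \<and> t \<le> c"
proof -
  interpret real_distribution "neg_deriv z"
    by (rule real_distribution_neg_deriv) (use assms in \<open>auto simp: termination_function_iff\<close>)
  show ?thesis
    using assms AE_in_set_eq_1[of "{0..c}"]
    by (simp add: termination_function_def emeasure_eq_measure)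
qed

text \<open>
  The measure \<open>neg_deriv z\<close> only determines the right limits of \<open>z\<close>; inside an integral these are as good
  as the values.
\<close>
lemma negligible_right_limit_neq:
  fixes z :: "real \<Rightarrow> real"
  assumes "antimono z"
  shows "negligible {x. Lim (at_right (x - b)) z \<noteq> z (x - b)}"
proof -
  have "countable {x. \<not> isCont (\<lambda>x. - z x) x}"
    using assms by (intro mono_ctble_discont) (auto simp: antimono_def mono_def)
  then have "countable ((\<lambda>x. x + b) ` {x. \<not> isCont (\<lambda>x. - z x) x})"
    by (rule countable_image)
  moreover have "Lim (at_right x) z = z x" if "isCont (\<lambda>x. - z x) x" for x
  proof (rule tendsto_Lim)
    have "isCont z x" using isCont_minus[OF that] by simp
    then show "(z \<longlongrightarrow> z x) (at_right x)"
      by (simp add: isCont_def filterlim_at_split)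
  qed simp
  then have "{x. Lim (at_right (x - b)) z \<noteq> z (x - b)} \<subseteq> (\<lambda>x. x + b) ` {x. \<not> isCont (\<lambda>x. - z x) x}"
    by (force intro!: image_eqI[of _ _ "_ - b"])
  ultimately have "countable {x. Lim (at_right (x - b)) z \<noteq> z (x - b)}"
    using countable_subset by blast
  then show ?thesis
    by (intro negligible_iff_null_sets[THEN iffD2] null_sets_completionI countable_imp_null_set_lborel)
qed

text \<open>For \<open>t < a\<close> the integral over the empty interval \<open>{a..t}\<close> is \<open>0\<close>.\<close>
lemma continuous_on_integral_upper:
  fixes f :: "real \<Rightarrow> real"
  assumes "\<And>b. a \<le> b \<Longrightarrow> f integrable_on {a..b}"
  shows "continuous_on UNIV (\<lambda>t. integral {a..t} f)"
proof -
  have "continuous_on ({..a} \<union> {a..}) (\<lambda>t. integral {a..t} f)"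
  proof (rule continuous_on_closed_Un)
    have "integral {a..t} f = 0" if "t \<le> a" for t
      using that by (cases "t = a") auto
    then show "continuous_on {..a} (\<lambda>t. integral {a..t} f)"
      by (subst continuous_on_cong[OF refl, of _ _ "\<lambda>_. 0"]) auto
    show "continuous_on {a..} (\<lambda>t. integral {a..t} f)"
      unfolding continuous_on_eq_continuous_within
    proof
      fix x assume "x \<in> {a..}"
      then have "continuous (at x within {a..x + 1}) (\<lambda>t. integral {a..t} f)"
        using indefinite_integral_continuous_1[OF assms[of "x + 1"]]
        by (simp add: continuous_on_eq_continuous_within)
      moreover have "at x within {a..x + 1} = at x within {a..}"
        by (rule at_within_nhd[of x "{..<x + 1}"]) auto
      ultimately show "continuous (at x within {a..}) (\<lambda>t. integral {a..t} f)"
        by (simp add: continuous_within)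
    qed
  qed auto
  moreover have "{..a} \<union> {a..} = UNIV" by auto
  ultimately show ?thesis by simp
qed

text \<open>
  Added to \<open>integral {a..b} f\<close>, the terminated integral becomes the mean of \<open>integral {a..b + t} f\<close>
  under \<open>neg_deriv z\<close>.
\<close>
lemma
  fixes f z :: "real \<Rightarrow> real"
  assumes z: "termination_function c z" and "a \<le> b"
    and f: "\<And>b. a \<le> b \<Longrightarrow> f integrable_on {a..b}"
  shows integrable_indefinite_integral_neg_deriv:
      "integrable (neg_deriv z) (\<lambda>t. integral {a..b + t} f)"
    and has_integral_mult_termination_function:
      "((\<lambda>x. f x * z (x - b)) has_integral
        ((LINT t|neg_deriv z. integral {a..b + t} f) - integral {a..b} f)) {b..b + c}"
proof -
  let ?F = "\<lambda>t. integral {a..t} f"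
  have z': "0 < c" "\<And>x. x \<le> 0 \<Longrightarrow> z x = 1" "\<And>x. x \<ge> c \<Longrightarrow> z x = 0" "antimono z"
    using z by (auto simp: termination_function_iff)
  interpret M: real_distribution "neg_deriv z"
    by (rule real_distribution_neg_deriv[OF z'])
  \<comment> \<open>the measure translated to the window \<open>{b..b + c}\<close>\<close>
  define N where "N = distr (neg_deriv z) borel (\<lambda>t. b + t)"
  interpret N: real_distribution N
    unfolding N_def by (rule M.real_distribution_distr) simp
  note AE = AE_neg_deriv[OF z]
  have F_cont: "continuous_on A ?F" for A
    using continuous_on_integral_upper[OF f] continuous_on_subset by blast
  have [measurable]: "?F \<in> borel_measurable borel"
    using F_cont by (rule borel_measurable_continuous_onI)
  have "set_integrable N {b..b + c} ?F"
    by (rule N.set_integrable_continuous_Icc[OF F_cont])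
  then have "integrable (neg_deriv z) (\<lambda>t. indicator {b..b + c} (b + t) * ?F (b + t))"
    unfolding set_integrable_def N_def by (subst (asm) integrable_distr_eq) auto
  then show int: "integrable (neg_deriv z) (\<lambda>t. ?F (b + t))"
    by (rule integrable_cong_AE_imp) (auto intro!: eventually_mono[OF AE])
  have meas: "measure N {x<..b + c} = Lim (at_right (x - b)) z" if "x \<in> {b..b + c}" for x
  proof -
    have "measure N {x<..b + c} = measure (neg_deriv z) {x - b<..c}"
      unfolding N_def by (subst measure_distr) (auto intro!: arg_cong[of _ _ "measure _"])
    also have "\<dots> = measure (neg_deriv z) (space (neg_deriv z) - {..x - b})"
      by (rule M.finite_measure_eq_AE) (auto intro!: eventually_mono[OF AE])
    also have "\<dots> = Lim (at_right (x - b)) z"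
      using cdf_neg_deriv[OF z', of "x - b"] by (subst M.prob_compl) (auto simp: cdf_def)
    finally show ?thesis .
  qed
  have f': "f integrable_on {b..b + c}"
    using f[of "b + c"] \<open>a \<le> b\<close> z'(1) by (auto intro: integrable_on_subinterval)
  have "(LINT t:{b<..b + c}|N. integral {b..t} f) = (LINT t:{b<..b + c}|N. ?F t - ?F b)"
  proof (rule set_lebesgue_integral_cong)
    have "integral {b..t} f = ?F t - ?F b" if "b \<le> t" for t
      using Henstock_Kurzweil_Integration.integral_combine[of a b t f] f[of t] that \<open>a \<le> b\<close> by simp
    then show "\<forall>t. t \<in> {b<..b + c} \<longrightarrow> integral {b..t} f = ?F t - ?F b"
      by simp
  qed simp
  also have "\<dots> = (LINT t|neg_deriv z. indicator {b<..b + c} (b + t) * (?F (b + t) - ?F b))"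
    unfolding N_def set_lebesgue_integral_def by (subst integral_distr) auto
  also have "\<dots> = (LINT t|neg_deriv z. ?F (b + t) - ?F b)"
  proof (rule integral_cong_AE)
    \<comment> \<open>a point mass at \<open>0\<close> contributes nothing, since \<open>?F (b + t) - ?F b\<close> vanishes there\<close>
    show "AE t in neg_deriv z. indicator {b<..b + c} (b + t) * (?F (b + t) - ?F b) = ?F (b + t) - ?F b"
      by (rule eventually_mono[OF AE]) (auto simp: indicator_def)
  qed simp_all
  also have "\<dots> = (LINT t|neg_deriv z. ?F (b + t)) - ?F b"
    using int M.prob_space by simp
  finally have "((\<lambda>x. f x * measure N {x<..b + c}) has_integral
      ((LINT t|neg_deriv z. ?F (b + t)) - ?F b)) {b..b + c}"
    using N.has_integral_mult_measure_greaterThan[OF _ f'] z'(1) by simp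
  then show "((\<lambda>x. f x * z (x - b)) has_integral ((LINT t|neg_deriv z. ?F (b + t)) - ?F b)) {b..b + c}"
    by (rule has_integral_spike[OF negligible_right_limit_neq[OF z'(4), of b], rotated]) (simp add: meas)
qed

section \<open>Combination as averaging over shifts\<close>

lemma (in prob_space) tendsto_integral_shift:
  fixes g :: "real \<Rightarrow> real"
  assumes g: "(g \<longlongrightarrow> L) at_top"
    and ae: "AE s in M. 0 \<le> X s"
    and int: "\<And>b. a \<le> b \<Longrightarrow> integrable M (\<lambda>s. g (b + X s))"
  shows "((\<lambda>b. LINT s|M. g (b + X s)) \<longlongrightarrow> L) at_top"
proof (rule tendstoI)
  fix e :: real assume "e > 0"
  then have "eventually (\<lambda>x. dist (g x) L < e / 2) at_top"
    using g by (intro tendstoD) auto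
  then obtain B where B: "\<And>x. x \<ge> B \<Longrightarrow> \<bar>g x - L\<bar> < e / 2"
    by (auto simp: eventually_at_top_linorder dist_real_def)
  have "dist (LINT s|M. g (b + X s)) L < e" if b: "b \<ge> max a B" for b
  proof -
    have i: "integrable M (\<lambda>s. g (b + X s))" using int b by simp
    have "\<bar>LINT s|M. g (b + X s) - L\<bar> \<le> (LINT s|M. \<bar>g (b + X s) - L\<bar>)"
      by (rule integral_abs_bound)
    also have "\<dots> \<le> (LINT s|M. e / 2)"
    proof (rule integral_mono_AE)
      show "AE s in M. \<bar>g (b + X s) - L\<bar> \<le> e / 2"
        using ae
      proof eventually_elim
        case (elim s)
        then show ?case using B[of "b + X s"] b by simp
      qed
    qed (use i in auto)
    also have "\<dots> < e" using \<open>e > 0\<close> prob_space by simp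
    finally show ?thesis using i prob_space by (simp add: dist_real_def)
  qed
  then show "eventually (\<lambda>b. dist (LINT s|M. g (b + X s)) L < e) at_top"
    unfolding eventually_at_top_linorder by blast
qed

theorem theorem1:
  fixes f z\<^sub>1 z\<^sub>2 :: "real \<Rightarrow> real" and a c\<^sub>1 c\<^sub>2 :: real
  assumes "termination_function c\<^sub>1 z\<^sub>1"
    and "termination_function c\<^sub>2 z\<^sub>2"
    and "generalized_integrable f a c\<^sub>1 z\<^sub>1"
  shows "generalized_integrable f a (c\<^sub>1 + c\<^sub>2) (z\<^sub>1 \<odot> z\<^sub>2) \<and>
    generalized_integral f a (c\<^sub>1 + c\<^sub>2) (z\<^sub>1 \<odot> z\<^sub>2) = generalized_integral f a c\<^sub>1 z\<^sub>1"
proof -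
  let ?M = "neg_deriv z\<^sub>1" and ?N = "neg_deriv z\<^sub>2"
  define F where "F t = integral {a..t} f" for t
  have f: "f integrable_on {a..b}" if "a \<le> b" for b
    using assms(3) that by (simp add: generalized_integrable_def)
  define G where "G c z b = F b + integral {b..b + c} (\<lambda>x. f x * z (x - b))" for c z b
  have G_eq: "G c z b = (LINT t|neg_deriv z. F (b + t))"
    if "termination_function c z" "a \<le> b" for c z b
    using integral_unique[OF has_integral_mult_termination_function[OF that f]]
    by (simp add: G_def F_def)
  have z: "termination_function (c\<^sub>1 + c\<^sub>2) (z\<^sub>1 \<odot> z\<^sub>2)"
    by (rule termination_function_combined[OF assms(1,2)])
  have rd: "real_distribution ?M" "real_distribution ?N"
    using assms(1,2) unfolding termination_function_iff by (auto intro: real_distribution_neg_deriv)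
  interpret M: real_distribution ?M by (fact rd)
  interpret N: real_distribution ?N by (fact rd)
  interpret MN: pair_prob_space ?M ?N ..
  have [measurable]: "F \<in> borel_measurable borel"
    unfolding F_def using continuous_on_integral_upper[OF f] by (rule borel_measurable_continuous_onI)
  have Fubini: "integrable ?N (\<lambda>s. LINT t|?M. F (b + s + t))"
    "G (c\<^sub>1 + c\<^sub>2) (z\<^sub>1 \<odot> z\<^sub>2) b = (LINT s|?N. LINT t|?M. F (b + s + t))" if "a \<le> b" for b
  proof -
    have *: "neg_deriv (z\<^sub>1 \<odot> z\<^sub>2) = distr (?M \<Otimes>\<^sub>M ?N) borel (\<lambda>(t, s). t + s)"
      using neg_deriv_combined[OF assms(1,2)] by (simp add: convolution_def)
    have i: "integrable (?M \<Otimes>\<^sub>M ?N) (\<lambda>(t, s). F (b + s + t))"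
    proof -
      have "integrable (neg_deriv (z\<^sub>1 \<odot> z\<^sub>2)) (\<lambda>t. F (b + t))"
        unfolding F_def by (rule integrable_indefinite_integral_neg_deriv[OF z that f])
      then show ?thesis
        unfolding * by (subst (asm) integrable_distr_eq) (auto simp: case_prod_unfold ac_simps)
    qed
    show "integrable ?N (\<lambda>s. LINT t|?M. F (b + s + t))"
      using MN.integrable_snd[OF i] .
    have "G (c\<^sub>1 + c\<^sub>2) (z\<^sub>1 \<odot> z\<^sub>2) b = (LINT p|(?M \<Otimes>\<^sub>M ?N). (\<lambda>(t, s). F (b + s + t)) p)"
      unfolding G_eq[OF z that] * by (subst integral_distr) (auto simp: case_prod_unfold ac_simps)
    also have "\<dots> = (LINT s|?N. LINT t|?M. F (b + s + t))"
      using MN.integral_snd[OF i] by simp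
    finally show "G (c\<^sub>1 + c\<^sub>2) (z\<^sub>1 \<odot> z\<^sub>2) b = (LINT s|?N. LINT t|?M. F (b + s + t))" .
  qed
  obtain L where L: "(G c\<^sub>1 z\<^sub>1 \<longlongrightarrow> L) at_top"
    using assms(3) by (auto simp: generalized_integrable_def G_def[abs_def] F_def)
  have L': "((\<lambda>b. LINT t|?M. F (b + t)) \<longlongrightarrow> L) at_top"
    by (rule Lim_transform_eventually[OF L])
      (auto simp: eventually_at_top_linorder G_eq[OF assms(1)] intro!: exI[of _ a])
  have "((\<lambda>b. LINT s|?N. LINT t|?M. F (b + s + t)) \<longlongrightarrow> L) at_top"
    by (rule N.tendsto_integral_shift[OF L'])
      (use AE_neg_deriv[OF assms(2)] Fubini(1) in auto)
  then have lim: "(G (c\<^sub>1 + c\<^sub>2) (z\<^sub>1 \<odot> z\<^sub>2) \<longlongrightarrow> L) at_top"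
    by (rule Lim_transform_eventually)
      (auto simp: eventually_at_top_linorder Fubini(2) intro!: exI[of _ a])
  have "(\<lambda>x. f x * (z\<^sub>1 \<odot> z\<^sub>2) (x - b)) integrable_on {b..b + (c\<^sub>1 + c\<^sub>2)}" if "a \<le> b" for b
    using has_integral_mult_termination_function[OF z that f] by blast
  then have "generalized_integrable f a (c\<^sub>1 + c\<^sub>2) (z\<^sub>1 \<odot> z\<^sub>2)"
    using f lim by (auto simp: generalized_integrable_def G_def[abs_def] F_def)
  moreover have "generalized_integral f a (c\<^sub>1 + c\<^sub>2) (z\<^sub>1 \<odot> z\<^sub>2) = L" "generalized_integral f a c\<^sub>1 z\<^sub>1 = L"
    using tendsto_Lim[OF _ lim] tendsto_Lim[OF _ L]
    by (simp_all add: generalized_integral_def G_def[abs_def] F_def)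
  ultimately show ?thesis by simp
qed

end
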